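(* Let $G$ be the extended integer Heisenberg group. Let $n,k$ be integers, not both zero, with $n$ even, and let $w$ be any fixed solution of $\frac{k}{(k,2n)}w\equiv 1\pmod{\frac{2n}{(2n,k)}}$. Two elements $x_1=(p_1,c_1,n,k)$ and $x_2=(p_2,c_2,n,k)$ of $G$ are conjugate in $G$ if and only if they are $0$-equivalent or $1$-equivalent.
   Context: The extended integer Heisenberg group $G$ is the set $\mathbb{Z}^4$ of tuples $(p,c,n,k)$ with multiplication $$(p',c',n',k')*(p_1,c_1,n_1,k_1)=\Bigl(p'+p_1+k'n_1,\ c_1+c'+k'\tfrac{n_1(n_1-1)}{2}+n'(p_1+k'n_1),\ n_1+n',\ k_1+k'\Bigr).$$ $(a,b)$ and $(a,b,c)$ inside moduli and coefficients denote greatest common divisors of integers; congruence modulo $0$ means equality. For $x_1=(p_1,c_1,n,k)$ and $x_2=(p_2,c_2,n,k)$ with $n$ even and $w$ as in the claim: $x_1,x_2$ are $0$-equivalent if $$p_1\equiv p_2\pmod{(2n,k)}\quad\text{and}\quad -p_1^2w-(2n,k)(2c_1+p_1)\equiv-p_2^2w-(2n,k)(2c_2+p_2)\pmod{2n(2n,k,2p_1)}.$$ $x_1,x_2$ are $1$-equivalent if $$p_1\equiv p_2+n\pmod{(2n,k)}\quad\text{and}\quad -p_1^2w-(2n,k)(2c_1+p_1)-wn(2p_1+n)\equiv-p_2^2w-(2n,k)(2c_2+p_2)\pmod{2n(2n,k,2p_1)}.$$ *)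

theory Defs
  imports "HOL-Algebra.Group" "HOL-Number_Theory.Cong"
begin

type_synonym heis = "int \<times> int \<times> int \<times> int"

(* The division by 2 is exact, since n1 * (n1 - 1) is even. *)
fun heis_mult :: "heis \<Rightarrow> heis \<Rightarrow> heis" where
  "heis_mult (p', c', n', k') (p1, c1, n1, k1) =
    (p' + p1 + k' * n1,
     c1 + c' + k' * (n1 * (n1 - 1) div 2) + n' * (p1 + k' * n1),
     n1 + n',
     k1 + k')"

definition ext_heisenberg :: "heis monoid" where
  "ext_heisenberg = \<lparr>carrier = UNIV, monoid.mult = heis_mult, one = (0, 0, 0, 0)\<rparr>"

definition conjugate_in :: "('a, 'b) monoid_scheme \<Rightarrow> 'a \<Rightarrow> 'a \<Rightarrow> bool" where
  "conjugate_in G x y \<longleftrightarrow> (\<exists>g\<in>carrier G. g \<otimes>\<^bsub>G\<^esub> x \<otimes>\<^bsub>G\<^esub> inv\<^bsub>G\<^esub> g = y)"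

(* Both relations are only defined for elements with the same last two coordinates;
   they are false for all other pairs.  Congruence modulo 0 is equality. *)
fun zero_equiv :: "int \<Rightarrow> heis \<Rightarrow> heis \<Rightarrow> bool" where
  "zero_equiv w (p1, c1, n, k) (p2, c2, n2, k2) \<longleftrightarrow>
     n2 = n \<and> k2 = k \<and>
     [p1 = p2] (mod gcd (2 * n) k) \<and>
     [- (p1\<^sup>2 * w) - gcd (2 * n) k * (2 * c1 + p1)
        = - (p2\<^sup>2 * w) - gcd (2 * n) k * (2 * c2 + p2)]
       (mod 2 * n * gcd (gcd (2 * n) k) (2 * p1))"

fun one_equiv :: "int \<Rightarrow> heis \<Rightarrow> heis \<Rightarrow> bool" where
  "one_equiv w (p1, c1, n, k) (p2, c2, n2, k2) \<longleftrightarrow>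
     n2 = n \<and> k2 = k \<and>
     [p1 = p2 + n] (mod gcd (2 * n) k) \<and>
     [- (p1\<^sup>2 * w) - gcd (2 * n) k * (2 * c1 + p1) - w * n * (2 * p1 + n)
        = - (p2\<^sup>2 * w) - gcd (2 * n) k * (2 * c2 + p2)]
       (mod 2 * n * gcd (gcd (2 * n) k) (2 * p1))"

lemma triangle_add:
  "(a + b) * (a + b - 1) div 2 = a * (a - 1) div 2 + b * (b - 1) div 2 + a * (b::int)"
proof -
  have e: "even (x * (x - 1))" for x :: int
    by simp
  have "(a + b) * (a + b - 1) = a * (a - 1) + b * (b - 1) + 2 * (a * b)"
    by (simp add: algebra_simps)
  then show ?thesis
    using e[of a] e[of b] by (simp add: div_plus_div_distrib_dvd_left)
qed

lemma heis_mult_assoc: "heis_mult (heis_mult x y) z = heis_mult x (heis_mult y z)"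
  by (cases x; cases y; cases z)
    (simp only: heis_mult.simps prod.inject triangle_add, simp add: algebra_simps)

lemma group_ext_heisenberg: "group ext_heisenberg"
proof (rule groupI)
  fix x assume "x \<in> carrier ext_heisenberg"
  obtain p c n k where x: "x = (p, c, n, k)"
    by (cases x)
  have "heis_mult (k * n - p, - c + k * (n * (n - 1) div 2) + n * (p - k * n), - n, - k) x
      = (0, 0, 0, 0)"
    by (simp add: x algebra_simps)
  then show "\<exists>y\<in>carrier ext_heisenberg. y \<otimes>\<^bsub>ext_heisenberg\<^esub> x = \<one>\<^bsub>ext_heisenberg\<^esub>"
    by (auto simp: ext_heisenberg_def)
qed (auto simp: ext_heisenberg_def heis_mult_assoc)

end

(* Conjugating by (r, s, a, b) changes p1 by b n - k a, and solvability for r turns the second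
   coordinate into a congruence modulo 2 n. For b = e + 2 b' with e = 0 or 1, all solutions
   (a, b') of p2 = p1 + b n - k a form a coset of the multiples of (2 n / d, k / d), d = gcd (2 n) k,
   with base point given by w. Moving along this coset changes d times the congruence by
   multiples of 4 n p1 modulo 2 n d, hence the modulus 2 n gcd d (2 p1). The parities e = 0, 1 of b
   give 0-equivalence and 1-equivalence. *)

theory Submission
  imports Defs
begin

text \<open>Clears the inverse, so that conjugacy becomes four polynomial equations in the
  coordinates.\<close>

lemma conjugate_in_iff_commute:
  assumes "group G" "x \<in> carrier G" "y \<in> carrier G"
  shows "conjugate_in G x y \<longleftrightarrow> (\<exists>g\<in>carrier G. g \<otimes>\<^bsub>G\<^esub> x = y \<otimes>\<^bsub>G\<^esub> g)"
proof -
  interpret group G by fact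
  have "g \<otimes>\<^bsub>G\<^esub> x \<otimes>\<^bsub>G\<^esub> inv\<^bsub>G\<^esub> g = y \<longleftrightarrow> g \<otimes>\<^bsub>G\<^esub> x = y \<otimes>\<^bsub>G\<^esub> g" if "g \<in> carrier G" for g
    using assms that by (metis inv_solve_right' m_closed)
  then show ?thesis
    by (auto simp: conjugate_in_def)
qed

text \<open>For a conjugator \<open>(r, s, a, b)\<close> the entry \<open>s\<close> cancels, and
  \<open>r\<close> enters only as \<open>n * r\<close> in the second coordinate. Doubling that
  equation clears the halves in the triangular numbers, hence the modulus
  \<open>2 * n\<close>.\<close>

lemma ext_heisenberg_conjugate_iff:
  "conjugate_in ext_heisenberg (p1, c1, n, k) (p2, c2, n, k) \<longleftrightarrow>
    (\<exists>a b. p2 = p1 + b * n - k * a \<and>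
      2 * n dvd 2 * (c2 - c1) - b * n * (n - 1) - 2 * a * p1 + k * a * (a - 1))"
    (is "_ \<longleftrightarrow> ?R" is "_ \<longleftrightarrow> (\<exists>a b. ?p a b \<and> _ dvd ?F a b)")
proof -
  have double: "2 * (x * (x - 1) div 2) = x * (x - 1)" for x :: int
    by simp
  have second: "c1 + s + b * (n * (n - 1) div 2) + a * (p1 + b * n)
      = s + c2 + k * (a * (a - 1) div 2) + n * (r + k * a) \<longleftrightarrow>
    ?F a b = 2 * n * (a * b - k * a - r)" (is "?l = ?r \<longleftrightarrow> _ = ?j") for a b r s
  proof -
    have "?F a b - ?j = 2 * (?r - ?l)"
      by (simp only: distrib_left right_diff_distrib mult.left_commute[of 2] double)
        (simp add: algebra_simps)
    moreover have "l = r \<longleftrightarrow> f = j" if "f - j = 2 * (r - l)" for l r f j :: int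
      using that by auto
    ultimately show ?thesis
      by blast
  qed
  have commute: "heis_mult (r, s, a, b) (p1, c1, n, k) = heis_mult (p2, c2, n, k) (r, s, a, b)
      \<longleftrightarrow> ?p a b \<and> ?F a b = 2 * n * (a * b - k * a - r)" for r s a b
    unfolding heis_mult.simps prod.inject second by auto
  have "conjugate_in ext_heisenberg (p1, c1, n, k) (p2, c2, n, k) \<longleftrightarrow>
    (\<exists>r s a b. heis_mult (r, s, a, b) (p1, c1, n, k) = heis_mult (p2, c2, n, k) (r, s, a, b))"
    by (subst conjugate_in_iff_commute[OF group_ext_heisenberg])
      (auto simp: ext_heisenberg_def)
  also have "(\<exists>r s a b. heis_mult (r, s, a, b) (p1, c1, n, k) = heis_mult (p2, c2, n, k) (r, s, a, b))
    \<longleftrightarrow> (\<exists>r a b. ?p a b \<and> ?F a b = 2 * n * (a * b - k * a - r))"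
    unfolding commute by blast
  also have "(\<exists>r a b. ?p a b \<and> ?F a b = 2 * n * (a * b - k * a - r)) \<longleftrightarrow> ?R"
  proof
    show ?R if "\<exists>r a b. ?p a b \<and> ?F a b = 2 * n * (a * b - k * a - r)"
      using that by (metis dvd_triv_left)
  next
    assume ?R
    then obtain a b j where "?p a b" "?F a b = 2 * n * j"
      by (metis dvdE)
    \<comment> \<open>Exhibits the witness \<open>r = a * b - k * a - j\<close>.\<close>
    moreover have "j = a * b - k * a - (a * b - k * a - j)"
      by simp
    ultimately show "\<exists>r a b. ?p a b \<and> ?F a b = 2 * n * (a * b - k * a - r)"
      by metis
  qed
  finally show ?thesis .
qed

text \<open>The first assumption is a Bezout identity for \<open>k\<close> and \<open>v\<close>, so
  \<open>t\<close> is explicit. The lemma is applied to the quotients of \<open>k\<close> and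
  \<open>2 * n\<close> by their gcd.\<close>

lemma coprime_homogeneous_solution:
  fixes a b k v u w :: int
  assumes "k * w = 1 + v * u" and "v * b = k * a"
  obtains t where "a = v * t" "b = k * t"
proof
  show "a = v * (b * w - a * u)" "b = k * (b * w - a * u)"
    using assms by algebra+
qed

(* The variable b' stands for half of b - e in the conjugation equations. *)
lemma fixed_parity_solution_iff:
  fixes n k w d e p1 p2 C :: int
  assumes "\<not> (n = 0 \<and> k = 0)" and "even n"
    and w: "[k div d * w = 1] (mod 2 * n div d)"
    and d: "d = gcd (2 * n) k" and e: "e * e = e"
  shows "(\<exists>a b'. p2 = p1 + (e + 2 * b') * n - k * a \<and>
        2 * n dvd 2 * C - (e + 2 * b') * n * (n - 1) - 2 * a * p1 + k * a * (a - 1)) \<longleftrightarrow>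
      d dvd p2 - p1 - e * n \<and>
      2 * n * gcd d (2 * p1) dvd
        2 * d * C + d * (p2 - p1) - w * (p1\<^sup>2 - p2\<^sup>2 + e * n * (2 * p1 + n))"
    (is "(\<exists>a b'. ?p a b' \<and> 2 * n dvd ?F a b') \<longleftrightarrow> ?dvd \<and> ?M dvd ?T")
proof -
  have d0: "d \<noteq> 0"
    using assms(1) d by auto
  obtain m where m: "n = 2 * m"
    using \<open>even n\<close> by blast
  obtain v \<kappa> where v: "2 * n = d * v" and \<kappa>: "k = d * \<kappa>"
    using d by (metis dvdE gcd_dvd1 gcd_dvd2)
  have "[\<kappa> * w = 1] (mod v)"
    using w d0 by (simp add: v \<kappa>)
  then obtain u where u: "\<kappa> * w = 1 + v * u"
    by (metis cong_iff_lin cong_sym)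
  \<comment> \<open>After division by \<open>d\<close> the equation reads
    \<open>v * b' - \<kappa> * a = q\<close>. Scaling \<open>\<kappa> * w - v * u = 1\<close> by
    \<open>q\<close> gives the solution at \<open>t = 0\<close>.\<close>
  have base: "?p (- (w * q) + v * t) (- (u * q) + \<kappa> * t)"
    if "p2 = p1 + e * n + d * q" for q t
    using that v \<kappa> u by algebra
  \<comment> \<open>Modulo \<open>2 * n * d\<close>, \<open>t\<close> survives only through
    \<open>- 2 * a * p1\<close>, because \<open>d * v = 2 * n\<close>.\<close>
  have change: "2 * n * d dvd d * ?F (- (w * q) + v * t) (- (u * q) + \<kappa> * t) - (?T - 4 * n * t * p1)"
    if q: "p2 = p1 + e * n + d * q" for q t
  proof -
    \<comment> \<open>The explicit quotient. Its summand \<open>- (e * m)\<close> comes from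
      \<open>- d * e * n * n\<close>, where evenness of \<open>n\<close> enters.\<close>
    let ?X = "- (e * m) + (u * q - \<kappa> * t) * (n - 1) - e * q * w + u * (w * q * q + q)
      + \<kappa> * (- (2 * w * q * t) + v * t * t - t)"
    \<comment> \<open>Since \<open>e * e = e\<close>, the term \<open>e * n * (2 * p1 + n)\<close>
      cancels the part of \<open>p1\<^sup>2 - p2\<^sup>2\<close> free of \<open>q\<close>.\<close>
    have T: "?T = 2 * d * C + d * e * n + d * d * q + 2 * e * n * d * q * w
        + 2 * p1 * d * q * w + w * d * d * q * q"
      using q e by algebra
    have "d * ?F (- (w * q) + v * t) (- (u * q) + \<kappa> * t) - (?T - 4 * n * t * p1) = 2 * n * d * ?X"
      unfolding T using m v \<kappa> u by algebra
    then show ?thesis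
      by (metis dvd_triv_left)
  qed
  have M: "?M dvd 2 * n * d" "?M dvd 4 * n * t * p1" for t
  proof -
    show "?M dvd 2 * n * d"
      by (intro mult_dvd_mono dvd_refl gcd_dvd1)
    have "?M dvd 2 * n * (2 * p1 * t)"
      by (metis gcd_dvd2 dvd_mult2 mult_dvd_mono dvd_refl)
    then show "?M dvd 4 * n * t * p1"
      by (simp add: algebra_simps)
  qed
  show ?thesis
  proof (intro iffI conjI; (elim exE conjE)?)
    fix a b' assume p: "?p a b'" and F: "2 * n dvd ?F a b'"
    have "p2 - p1 - e * n = d * (v * b' - \<kappa> * a)"
      using p v \<kappa> by algebra
    then show ?dvd
      by simp
    define q where "q = v * b' - \<kappa> * a"
    have q: "p2 = p1 + e * n + d * q"
      using p v \<kappa> q_def by algebra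
    \<comment> \<open>Subtracting the base point leaves a solution of the homogeneous
      equation.\<close>
    have "v * (b' + u * q) = \<kappa> * (a + w * q)"
      using q_def u by algebra
    then obtain t where "a + w * q = v * t" "b' + u * q = \<kappa> * t"
      using coprime_homogeneous_solution[OF u] by metis
    then have ab: "a = - (w * q) + v * t" "b' = - (u * q) + \<kappa> * t"
      by auto
    have "2 * n * d dvd d * ?F a b'"
      using F by (metis mult.commute mult_dvd_mono dvd_refl)
    then have "2 * n * d dvd ?T - 4 * n * t * p1"
      using change[OF q, of t] unfolding ab[symmetric] by (metis dvd_diff_right_iff)
    with M(1) have "?M dvd ?T - 4 * n * t * p1"
      by (rule dvd_trans)
    then show "?M dvd ?T"
      by (simp only: dvd_diff_left_iff[OF M(2)])
  next
    assume ?dvd and T: "?M dvd ?T"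
    then obtain q where "p2 - p1 - e * n = d * q"
      by (metis dvdE)
    then have q: "p2 = p1 + e * n + d * q"
      by simp
    \<comment> \<open>Bezout splits \<open>?T\<close> into a multiple of \<open>2 * n * d\<close>
      and \<open>4 * n * (y * z) * p1\<close>; the choice \<open>t = y * z\<close> removes the
      latter.\<close>
    obtain x y where xy: "x * d + y * (2 * p1) = gcd d (2 * p1)"
      using bezout_int by blast
    obtain z where z: "?T = ?M * z"
      using T by (metis dvdE)
    have "?T - 4 * n * (y * z) * p1 = 2 * n * d * (x * z)"
      unfolding z xy[symmetric] by (simp add: algebra_simps)
    then have "2 * n * d dvd ?T - 4 * n * (y * z) * p1"
      by (metis dvd_triv_left)
    then have "2 * n * d dvd d * ?F (- (w * q) + v * (y * z)) (- (u * q) + \<kappa> * (y * z))"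
      using change[OF q, of "y * z"] by (simp only: dvd_diff_left_iff)
    then have "2 * n dvd ?F (- (w * q) + v * (y * z)) (- (u * q) + \<kappa> * (y * z))"
      using d0 by (simp only: mult.commute[of _ d] dvd_mult_cancel_left) simp
    then show "\<exists>a b'. ?p a b' \<and> 2 * n dvd ?F a b'"
      using base[OF q] by blast
  qed
qed

theorem mainTheorem4:
  fixes n k w p1 c1 p2 c2 :: int
  assumes "\<not> (n = 0 \<and> k = 0)"
    and "even n"
    and "[k div gcd k (2 * n) * w = 1] (mod 2 * n div gcd (2 * n) k)"
  shows "conjugate_in ext_heisenberg (p1, c1, n, k) (p2, c2, n, k) \<longleftrightarrow>
    zero_equiv w (p1, c1, n, k) (p2, c2, n, k) \<or> one_equiv w (p1, c1, n, k) (p2, c2, n, k)"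
proof -
  define d where "d = gcd (2 * n) k"
  have w: "[k div d * w = 1] (mod 2 * n div d)"
    using assms(3) by (simp add: d_def gcd.commute)
  define Q where "Q a b \<longleftrightarrow> p2 = p1 + b * n - k * a \<and>
      2 * n dvd 2 * (c2 - c1) - b * n * (n - 1) - 2 * a * p1 + k * a * (a - 1)" for a b
  note iff = fixed_parity_solution_iff[OF assms(1,2) w d_def, of _ p2 p1 "c2 - c1", folded Q_def]
  have "[p1 = p2] (mod d) \<longleftrightarrow> d dvd p2 - p1 - 0 * n"
    by (simp add: cong_iff_dvd_diff dvd_diff_commute)
  \<comment> \<open>The two sides of the second congruence differ by exactly the number tested in
    \<open>iff\<close>, here for \<open>e = 0\<close>.\<close>
  moreover have
    "- (p1\<^sup>2 * w) - d * (2 * c1 + p1) - (- (p2\<^sup>2 * w) - d * (2 * c2 + p2))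
      = 2 * d * (c2 - c1) + d * (p2 - p1) - w * (p1\<^sup>2 - p2\<^sup>2 + 0 * n * (2 * p1 + n))"
    by (simp add: algebra_simps)
  ultimately have zero: "zero_equiv w (p1, c1, n, k) (p2, c2, n, k) \<longleftrightarrow> (\<exists>a b'. Q a (0 + 2 * b'))"
    unfolding zero_equiv.simps d_def[symmetric] iff[of 0, simplified mult_zero_left, OF refl]
    by (simp only: cong_iff_dvd_diff) simp
  \<comment> \<open>The shift by \<open>n\<close> has opposite signs on the two sides, which agree
    because \<open>d\<close> divides \<open>2 * n\<close>.\<close>
  have "[p1 = p2 + n] (mod d) \<longleftrightarrow> d dvd p2 - p1 - 1 * n"
  proof -
    have "d dvd 2 * n"
      by (simp add: d_def)
    then have "d dvd p2 - p1 - 1 * n \<longleftrightarrow> d dvd (p2 - p1 - 1 * n) + 2 * n"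
      by (simp only: dvd_add_left_iff)
    also have "(p2 - p1 - 1 * n) + 2 * n = p2 + n - p1"
      by simp
    finally show ?thesis
      by (simp only: cong_iff_dvd_diff dvd_diff_commute[of d p1])
  qed
  moreover have
    "- (p1\<^sup>2 * w) - d * (2 * c1 + p1) - w * n * (2 * p1 + n) - (- (p2\<^sup>2 * w) - d * (2 * c2 + p2))
      = 2 * d * (c2 - c1) + d * (p2 - p1) - w * (p1\<^sup>2 - p2\<^sup>2 + 1 * n * (2 * p1 + n))"
    by (simp add: algebra_simps)
  ultimately have one: "one_equiv w (p1, c1, n, k) (p2, c2, n, k) \<longleftrightarrow> (\<exists>a b'. Q a (1 + 2 * b'))"
    unfolding one_equiv.simps d_def[symmetric] iff[of 1, simplified mult_1, OF refl]
    by (simp only: cong_iff_dvd_diff) simp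
  have "(\<exists>a b. Q a b) \<longleftrightarrow> (\<exists>a b'. Q a (0 + 2 * b')) \<or> (\<exists>a b'. Q a (1 + 2 * b'))"
    by (metis add.commute add_0 evenE oddE)
  then show ?thesis
    unfolding ext_heisenberg_conjugate_iff zero one Q_def by blast
qed

end
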